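(* Let $f,g_1,\dots,g_m\in\mathbb{R}[\mathbf{x}]$, $d_0=\deg f$, and let $\mathbf{K}=\{\mathbf{x}\in\mathbb{R}^n:g_j(\mathbf{x})\ge0,\ j=1,\dots,m\}$ have nonempty interior, with $0\in\mathbf{K}$. For every $k\in\{1,2,\infty\}$ and $d\in\mathbb{N}$, let $\tilde f_d\in\mathbb{R}[\mathbf{x}]_{d_0}$ be an optimal solution of $$\rho_d^k=\min_{\tilde f}\{\|\tilde f-f\|_k:\ \tilde f\in\mathbb{R}[\mathbf{x}]_{d_0},\ \tilde f-\tilde f(0)\in Q_d(g)\},$$ and let $\tilde f^*\in\mathbb{R}[\mathbf{x}]_{d_0}$ be an optimal solution of the ideal inverse problem $$\rho^k=\min_{\tilde f}\{\|\tilde f-f\|_k:\ \tilde f\in\mathbb{R}[\mathbf{x}]_{d_0},\ \tilde f-\tilde f(0)\in\mathrm{Psd}_{d_0}(\mathbf{K})\}.$$ The sequence $(\rho_d^k)_{d\in\mathbb{N}}$ is monotone nonincreasing and converges to some $\hat\rho^k\ge\rho^k$. Moreover, every accumulation point $\hat f\in\mathbb{R}[\mathbf{x}]_{d_0}$ of the sequence $(\tilde f_d)_{d\in\mathbb{N}}$ is such that $\hat f-\hat f(0)\in\mathrm{Psd}_{d_0}(\mathbf{K})$ and $\|\hat f-f\|_k=\hat\rho^k$. Finally, if $\tilde f^*-\tilde f^*(0)$ is in $Q(g)$, then $\rho_d^k=\hat\rho^k=\rho^k$ for some $d$.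
   Context: $\mathbb{R}[\mathbf{x}]_t$ denotes real polynomials in $\mathbf{x}=(x_1,\dots,x_n)$ of degree at most $t$, $\Sigma[\mathbf{x}]$ the sums of squares of polynomials, and $\Sigma[\mathbf{x}]_r$ the sums of squares of degree at most $2r$ (so $\{0\}$ if $r<0$). With $g_0\equiv1$ and $v_j=\lceil(\deg g_j)/2\rceil$, $$Q(g)=\Big\{\sum_{j=0}^m\sigma_jg_j:\sigma_j\in\Sigma[\mathbf{x}]\Big\},\qquad Q_d(g)=\Big\{\sum_{j=0}^m\sigma_jg_j:\sigma_j\in\Sigma[\mathbf{x}]_{d-v_j}\Big\}.$$ $\mathrm{Psd}_t(\mathbf{K})\subset\mathbb{R}[\mathbf{x}]_t$ is the cone of polynomials of degree at most $t$ that are nonnegative on $\mathbf{K}$. For $h=\sum_\alpha h_\alpha\mathbf{x}^\alpha$: $\|h\|_1=\sum_\alpha|h_\alpha|$, $\|h\|_2=\sum_\alpha h_\alpha^2$ (no square root), $\|h\|_\infty=\max_\alpha|h_\alpha|$. Polynomials in $\mathbb{R}[\mathbf{x}]_{d_0}$ are identified with their coefficient vectors, and convergence is in that finite-dimensional space. The given feasible point of the inverse problem is $\mathbf{y}=0\in\mathbf{K}$. *)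

theory Defs
  imports "HOL-Analysis.Analysis" "HOL-Library.Poly_Mapping"
begin

text \<open>Real polynomials in the variables indexed by the finite type \<open>'n\<close> are finitely supported
  maps from exponent vectors to coefficients; \<open>*\<close> on this type is the convolution product.\<close>

type_synonym 'n rpoly = "('n \<Rightarrow>\<^sub>0 nat) \<Rightarrow>\<^sub>0 real"

definition poly_eval :: "'n::finite rpoly \<Rightarrow> real ^ 'n \<Rightarrow> real" where
  "poly_eval p x =
     (\<Sum>\<alpha>\<in>Poly_Mapping.keys p. Poly_Mapping.lookup p \<alpha> * (\<Prod>i\<in>UNIV. (x $ i) ^ Poly_Mapping.lookup \<alpha> i))"

definition const_poly :: "real \<Rightarrow> 'n::finite rpoly" where
  "const_poly c = Poly_Mapping.single 0 c"

text \<open>Total degree, with the convention that the zero polynomial has degree 0.\<close>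

definition tdegree :: "'n::finite rpoly \<Rightarrow> nat" where
  "tdegree p = Max (insert 0 ((\<lambda>\<alpha>. \<Sum>i\<in>UNIV. Poly_Mapping.lookup \<alpha> i) ` Poly_Mapping.keys p))"

definition polys_upto :: "nat \<Rightarrow> 'n::finite rpoly set" where
  "polys_upto t = {p. tdegree p \<le> t}"

definition sos :: "'n::finite rpoly set" where
  "sos = {\<Sum>i<N. (q i)\<^sup>2 | (N :: nat) (q :: nat \<Rightarrow> 'n rpoly). True}"

text \<open>The index is an integer since it arises as a difference that may be negative. The disjunct
  for 0 makes \<open>sos_upto r = {0}\<close> when \<open>r < 0\<close>, and is redundant otherwise.\<close>

definition sos_upto :: "int \<Rightarrow> 'n::finite rpoly set" where
  "sos_upto r = {\<sigma> \<in> sos. \<sigma> = 0 \<or> int (tdegree \<sigma>) \<le> 2 * r}"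

text \<open>The constraint polynomials are \<open>g 1, \<dots>, g m\<close>. The multiplier at index 0 is always the constant
  1, whatever the value \<open>g 0\<close> of the given function.\<close>

definition with_one :: "(nat \<Rightarrow> 'n::finite rpoly) \<Rightarrow> nat \<Rightarrow> 'n rpoly" where
  "with_one g j = (if j = 0 then 1 else g j)"

definition half_deg :: "'n::finite rpoly \<Rightarrow> int" where
  "half_deg p = \<lceil>real (tdegree p) / 2\<rceil>"

definition quad_module :: "nat \<Rightarrow> (nat \<Rightarrow> 'n::finite rpoly) \<Rightarrow> 'n rpoly set" where
  "quad_module m g = {\<Sum>j=0..m. \<sigma> j * with_one g j | \<sigma>. \<forall>j\<in>{0..m}. \<sigma> j \<in> sos}"

definition trunc_quad_module :: "nat \<Rightarrow> (nat \<Rightarrow> 'n::finite rpoly) \<Rightarrow> nat \<Rightarrow> 'n rpoly set" where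
  "trunc_quad_module m g d =
     {\<Sum>j=0..m. \<sigma> j * with_one g j | \<sigma>.
        \<forall>j\<in>{0..m}. \<sigma> j \<in> sos_upto (int d - half_deg (with_one g j))}"

definition semialg_set :: "nat \<Rightarrow> (nat \<Rightarrow> 'n::finite rpoly) \<Rightarrow> (real ^ 'n) set" where
  "semialg_set m g = {x. \<forall>j\<in>{1..m}. poly_eval (g j) x \<ge> 0}"

definition Psd :: "nat \<Rightarrow> (real ^ 'n::finite) set \<Rightarrow> 'n rpoly set" where
  "Psd t K = {p \<in> polys_upto t. \<forall>x\<in>K. poly_eval p x \<ge> 0}"

text \<open>Only the indices 1, 2 and \<open>\<infinity>\<close> are meaningful. For index 2 there is deliberately no
  square root. The range in the last case contains 0 and is finite.\<close>

definition coeff_norm :: "enat \<Rightarrow> 'n::finite rpoly \<Rightarrow> real" where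
  "coeff_norm k h =
     (if k = 1 then \<Sum>\<alpha>\<in>Poly_Mapping.keys h. \<bar>Poly_Mapping.lookup h \<alpha>\<bar>
      else if k = 2 then \<Sum>\<alpha>\<in>Poly_Mapping.keys h. (Poly_Mapping.lookup h \<alpha>)\<^sup>2
      else Max (range (\<lambda>\<alpha>. \<bar>Poly_Mapping.lookup h \<alpha>\<bar>)))"

text \<open>The inverse problem for \<open>f\<close> at the point 0 and a set \<open>C\<close> of admissible polynomials \<open>h - h(0)\<close>:
  the truncated problem takes \<open>C\<close> to be a truncated quadratic module, the ideal one takes
  \<open>C\<close> to be a cone of nonnegative polynomials.\<close>

definition inv_feasible :: "'n::finite rpoly \<Rightarrow> 'n rpoly set \<Rightarrow> 'n rpoly set" where
  "inv_feasible f C = {h \<in> polys_upto (tdegree f). h - const_poly (poly_eval h 0) \<in> C}"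

definition inv_value :: "enat \<Rightarrow> 'n::finite rpoly \<Rightarrow> 'n rpoly set \<Rightarrow> real" where
  "inv_value k f C = (INF h\<in>inv_feasible f C. coeff_norm k (h - f))"

definition inv_optimal :: "enat \<Rightarrow> 'n::finite rpoly \<Rightarrow> 'n rpoly set \<Rightarrow> 'n rpoly \<Rightarrow> bool" where
  "inv_optimal k f C h \<longleftrightarrow> is_arg_min (\<lambda>p. coeff_norm k (p - f)) (\<lambda>p. p \<in> inv_feasible f C) h"

text \<open>Polynomials are identified with their coefficient vectors. On polynomials of bounded degree
  the product topology of the function space is that of the finite-dimensional coefficient space.\<close>

definition accumulation_point :: "(nat \<Rightarrow> 'n::finite rpoly) \<Rightarrow> 'n rpoly \<Rightarrow> bool" where
  "accumulation_point F h \<longleftrightarrow>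
     (\<exists>r :: nat \<Rightarrow> nat. strict_mono r \<and>
        (\<lambda>i. Poly_Mapping.lookup (F (r i))) \<longlonglongrightarrow> Poly_Mapping.lookup h)"

end

theory Submission
  imports Defs
begin

text \<open>Three observations carry the theorem.

  The feasible sets are nested: the truncated quadratic modules increase with the order \<open>d\<close>, and
  each consists of polynomials that are nonnegative on \<open>K\<close>, since evaluation at a point is a ring
  homomorphism and sends sums of squares to nonnegative reals
  (\<open>trunc_quad_module_mono\<close>, \<open>trunc_quad_module_nonneg\<close>). Minimising one function over increasing
  sets gives nonincreasing values, and minimising it over a set containing them all gives a lower
  bound, so the values converge to a limit that is at least the ideal value.

  Polynomials of degree at most \<open>t\<close> have their coefficients in one fixed finite set of exponents.
  Hence point evaluation and the coefficient norms are continuous under coefficientwise convergence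
  within bounded degree (\<open>tendsto_poly_eval\<close>, \<open>tendsto_coeff_norm\<close>). Passing to the limit along a
  subsequence of optimal solutions preserves the inequalities \<open>h(x) - h(0) \<ge> 0\<close>, and the
  subsequence of optimal values still converges to the limit of the whole sequence.

  A representation in the quadratic module involves finitely many sums of squares, so it already
  lies in a truncated module of large enough order (\<open>quad_module_imp_trunc\<close>). If the ideal
  optimum has such a representation, it is feasible at that order, and the truncated value, the
  limit and the ideal value are squeezed together.\<close>

section \<open>Exponents of bounded degree\<close>

definition exponents_upto :: "nat \<Rightarrow> ('n::finite \<Rightarrow>\<^sub>0 nat) set" where
  "exponents_upto t = {\<alpha>. (\<Sum>i\<in>UNIV. Poly_Mapping.lookup \<alpha> i) \<le> t}"

definition monom_eval :: "('n::finite \<Rightarrow>\<^sub>0 nat) \<Rightarrow> real ^ 'n \<Rightarrow> real" where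
  "monom_eval \<alpha> x = (\<Prod>i\<in>UNIV. (x $ i) ^ Poly_Mapping.lookup \<alpha> i)"

lemma finite_exponents_upto: "finite (exponents_upto t :: ('n::finite \<Rightarrow>\<^sub>0 nat) set)"
proof -
  have "Poly_Mapping.lookup ` exponents_upto t
      \<subseteq> (Pi\<^sub>E UNIV (\<lambda>_. {..t}) :: ('n \<Rightarrow> nat) set)"
  proof (clarsimp simp: exponents_upto_def PiE_def Pi_def)
    fix \<alpha> :: "'n \<Rightarrow>\<^sub>0 nat" and i
    assume "(\<Sum>i\<in>UNIV. Poly_Mapping.lookup \<alpha> i) \<le> t"
    moreover have "Poly_Mapping.lookup \<alpha> i \<le> (\<Sum>i\<in>UNIV. Poly_Mapping.lookup \<alpha> i)"
      by (rule member_le_sum) auto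
    ultimately show "Poly_Mapping.lookup \<alpha> i \<le> t" by linarith
  qed
  then have "finite (Poly_Mapping.lookup ` (exponents_upto t :: ('n \<Rightarrow>\<^sub>0 nat) set))"
    by (rule finite_subset) (simp add: finite_PiE)
  then show ?thesis
    by (rule finite_imageD) (simp add: inj_on_def)
qed

lemma zero_in_exponents_upto: "0 \<in> exponents_upto t"
  by (simp add: exponents_upto_def)

lemma polys_upto_iff: "p \<in> polys_upto t \<longleftrightarrow> Poly_Mapping.keys p \<subseteq> exponents_upto t"
  by (auto simp: polys_upto_def tdegree_def exponents_upto_def)

lemma diff_const_in_polys_upto:
  assumes "h \<in> polys_upto t"
  shows "h - const_poly c \<in> polys_upto t"
proof -
  have "Poly_Mapping.keys (const_poly c) \<subseteq> exponents_upto t"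
    using zero_in_exponents_upto by (auto simp: const_poly_def)
  then show ?thesis
    using assms keys_diff[of h "const_poly c"] unfolding polys_upto_iff by blast
qed

section \<open>Evaluation as a ring homomorphism\<close>

text \<open>Summing over a common finite superset of the supports makes evaluation visibly linear and,
  later, continuous in the coefficients.\<close>

lemma poly_eval_eq_sum:
  assumes "finite S" "Poly_Mapping.keys p \<subseteq> S"
  shows "poly_eval p x = (\<Sum>\<alpha>\<in>S. Poly_Mapping.lookup p \<alpha> * monom_eval \<alpha> x)"
  unfolding poly_eval_def monom_eval_def
  using assms by (intro sum.mono_neutral_left) (auto simp: in_keys_iff)

lemma poly_eval_add: "poly_eval (p + q) x = poly_eval p x + poly_eval q x"
proof -
  let ?S = "Poly_Mapping.keys p \<union> Poly_Mapping.keys q"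
  have "Poly_Mapping.keys (p + q) \<subseteq> ?S" by (rule Poly_Mapping.keys_add)
  then show ?thesis
    by (simp add: poly_eval_eq_sum[of ?S] lookup_add algebra_simps sum.distrib)
qed

lemma poly_eval_diff: "poly_eval (p - q) x = poly_eval p x - poly_eval q x"
  using poly_eval_add[of "p - q" q x] by simp

lemma poly_eval_zero: "poly_eval 0 x = 0"
  by (simp add: poly_eval_def)

lemma poly_eval_sum: "poly_eval (\<Sum>a\<in>A. p a) x = (\<Sum>a\<in>A. poly_eval (p a) x)"
  by (induction A rule: infinite_finite_induct) (simp_all add: poly_eval_zero poly_eval_add)

lemma poly_eval_single: "poly_eval (Poly_Mapping.single \<alpha> c) x = c * monom_eval \<alpha> x"
  by (subst poly_eval_eq_sum[of "{\<alpha>}"]) auto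

lemma poly_eval_const: "poly_eval (const_poly c) x = c"
  by (simp add: const_poly_def poly_eval_single monom_eval_def)

lemma poly_eval_one: "poly_eval 1 x = 1"
  using poly_eval_const[of 1 x] by (simp add: const_poly_def)

text \<open>The convolution product is determined by bilinearity and its values on single terms, so it
  suffices that adding exponent vectors multiplies the monomials.\<close>

lemma poly_eval_mult: "poly_eval (p * q) x = poly_eval p x * poly_eval q x"
proof -
  let ?t = "\<lambda>r \<alpha>. Poly_Mapping.single \<alpha> (Poly_Mapping.lookup r \<alpha>)"
  have expand: "r = (\<Sum>\<alpha>\<in>Poly_Mapping.keys r. ?t r \<alpha>)" for r :: "'a rpoly"
    by (rule poly_mapping_eqI)
      (auto simp: lookup_sum lookup_single when_def in_keys_iff cong: if_cong)
  have single: "poly_eval (?t p \<alpha> * ?t q \<beta>) x = poly_eval (?t p \<alpha>) x * poly_eval (?t q \<beta>) x"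
    for \<alpha> \<beta>
    by (simp add: mult_single poly_eval_single monom_eval_def lookup_add power_add prod.distrib)
  have "poly_eval (p * q) x
      = poly_eval ((\<Sum>\<alpha>\<in>Poly_Mapping.keys p. ?t p \<alpha>) * (\<Sum>\<beta>\<in>Poly_Mapping.keys q. ?t q \<beta>)) x"
    using expand[of p] expand[of q] by simp
  also have "\<dots> = poly_eval (\<Sum>\<alpha>\<in>Poly_Mapping.keys p. ?t p \<alpha>) x
      * poly_eval (\<Sum>\<beta>\<in>Poly_Mapping.keys q. ?t q \<beta>) x"
    by (simp only: sum_product poly_eval_sum single)
  also have "\<dots> = poly_eval p x * poly_eval q x"
    using expand[of p] expand[of q] by simp
  finally show ?thesis .
qed

section \<open>Quadratic modules and their truncations\<close>

lemma sos_nonneg: "\<sigma> \<in> sos \<Longrightarrow> poly_eval \<sigma> x \<ge> 0"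
  by (auto simp: sos_def poly_eval_sum power2_eq_square poly_eval_mult intro!: sum_nonneg)

lemma trunc_quad_module_nonneg:
  assumes "p \<in> trunc_quad_module m g d" "x \<in> semialg_set m g"
  shows "poly_eval p x \<ge> 0"
proof -
  obtain \<sigma> where \<sigma>: "p = (\<Sum>j=0..m. \<sigma> j * with_one g j)"
      "\<forall>j\<in>{0..m}. \<sigma> j \<in> sos_upto (int d - half_deg (with_one g j))"
    using assms(1) by (auto simp: trunc_quad_module_def)
  have "poly_eval (\<sigma> j) x * poly_eval (with_one g j) x \<ge> 0" if "j \<in> {0..m}" for j
  proof (rule mult_nonneg_nonneg)
    show "poly_eval (\<sigma> j) x \<ge> 0"
      using \<sigma>(2) that by (auto simp: sos_upto_def intro: sos_nonneg)
    show "poly_eval (with_one g j) x \<ge> 0"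
      using assms(2) that by (auto simp: with_one_def semialg_set_def poly_eval_one)
  qed
  then show ?thesis
    by (auto simp: \<sigma>(1) poly_eval_sum poly_eval_mult intro!: sum_nonneg)
qed

lemma trunc_quad_module_mono:
  assumes "d \<le> e"
  shows "trunc_quad_module m g d \<subseteq> trunc_quad_module m g e"
proof -
  have "sos_upto (int d - r) \<subseteq> sos_upto (int e - r)" for r
    using assms by (auto simp: sos_upto_def)
  then show ?thesis
    unfolding trunc_quad_module_def by blast
qed

lemma quad_module_imp_trunc:
  assumes "p \<in> quad_module m g"
  obtains d where "p \<in> trunc_quad_module m g d"
proof -
  obtain \<sigma> where \<sigma>: "p = (\<Sum>j=0..m. \<sigma> j * with_one g j)" "\<forall>j\<in>{0..m}. \<sigma> j \<in> sos"
    using assms by (auto simp: quad_module_def)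
  \<comment> \<open>The order \<open>b j\<close> admits \<open>\<sigma> j\<close> as a multiplier, with a margin of a factor 2 in the degree;
    the sum of these orders dominates each of them.\<close>
  define b where "b j = nat (int (tdegree (\<sigma> j)) + half_deg (with_one g j))" for j
  define d where "d = (\<Sum>j=0..m. b j)"
  have "\<sigma> j \<in> sos_upto (int d - half_deg (with_one g j))" if "j \<in> {0..m}" for j
  proof -
    have "b j \<le> d"
      unfolding d_def using that by (intro member_le_sum) auto
    then have "int (tdegree (\<sigma> j)) + half_deg (with_one g j) \<le> int d"
      unfolding b_def by (simp add: nat_le_iff)
    then have "int (tdegree (\<sigma> j)) \<le> 2 * (int d - half_deg (with_one g j))"
      using of_nat_0_le_iff[of "tdegree (\<sigma> j)"] by (smt (verit))
    then show ?thesis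
      using \<sigma>(2) that by (auto simp: sos_upto_def)
  qed
  then have "p \<in> trunc_quad_module m g d"
    unfolding trunc_quad_module_def \<sigma>(1) by blast
  then show thesis by (rule that)
qed

lemma inv_feasible_trunc_subset_Psd:
  "inv_feasible f (trunc_quad_module m g d)
    \<subseteq> inv_feasible f (Psd (tdegree f) (semialg_set m g))"
  by (auto simp: inv_feasible_def Psd_def diff_const_in_polys_upto trunc_quad_module_nonneg)

section \<open>Coefficient norms\<close>

lemma finite_range_abs_lookup:
  "finite (range (\<lambda>\<alpha>. \<bar>Poly_Mapping.lookup (h :: 'n::finite rpoly) \<alpha>\<bar>))"
proof (rule finite_subset)
  show "range (\<lambda>\<alpha>. \<bar>Poly_Mapping.lookup h \<alpha>\<bar>)
      \<subseteq> insert 0 ((\<lambda>\<alpha>. \<bar>Poly_Mapping.lookup h \<alpha>\<bar>) ` Poly_Mapping.keys h)"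
    by (auto simp: in_keys_iff)
qed simp

lemma coeff_norm_nonneg: "coeff_norm k h \<ge> 0"
proof -
  have "\<bar>Poly_Mapping.lookup h 0\<bar> \<le> Max (range (\<lambda>\<alpha>. \<bar>Poly_Mapping.lookup h \<alpha>\<bar>))"
    by (intro Max_ge finite_range_abs_lookup) auto
  then have "0 \<le> Max (range (\<lambda>\<alpha>. \<bar>Poly_Mapping.lookup h \<alpha>\<bar>))"
    using abs_ge_zero order_trans by blast
  then show ?thesis
    by (auto simp: coeff_norm_def intro: sum_nonneg)
qed

text \<open>Over a fixed finite set of exponents each of the norms becomes an explicit continuous
  expression in finitely many coefficients. In the maximum, the coefficients outside the set
  contribute only the value 0, which never exceeds an absolute value inside it.\<close>

lemma coeff_norm_eq:
  fixes h :: "'n::finite rpoly"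
  assumes "finite S" "S \<noteq> {}" "Poly_Mapping.keys h \<subseteq> S"
  shows "coeff_norm k h =
     (if k = 1 then \<Sum>\<alpha>\<in>S. \<bar>Poly_Mapping.lookup h \<alpha>\<bar>
      else if k = 2 then \<Sum>\<alpha>\<in>S. (Poly_Mapping.lookup h \<alpha>)\<^sup>2
      else Max ((\<lambda>\<alpha>. \<bar>Poly_Mapping.lookup h \<alpha>\<bar>) ` S))"
proof -
  let ?l = "\<lambda>\<alpha>. \<bar>Poly_Mapping.lookup h \<alpha>\<bar>"
  have "(\<Sum>\<alpha>\<in>Poly_Mapping.keys h. ?l \<alpha>) = (\<Sum>\<alpha>\<in>S. ?l \<alpha>)"
    using assms by (intro sum.mono_neutral_left) (auto simp: in_keys_iff)
  moreover have "(\<Sum>\<alpha>\<in>Poly_Mapping.keys h. (Poly_Mapping.lookup h \<alpha>)\<^sup>2)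
      = (\<Sum>\<alpha>\<in>S. (Poly_Mapping.lookup h \<alpha>)\<^sup>2)"
    using assms by (intro sum.mono_neutral_left) (auto simp: in_keys_iff)
  moreover have "Max (range ?l) = Max (?l ` S)"
  proof (rule antisym)
    have "?l \<alpha> \<le> Max (?l ` S)" for \<alpha>
    proof (cases "\<alpha> \<in> S")
      case False
      then have "?l \<alpha> = 0" using assms(3) by (auto simp: in_keys_iff)
      moreover obtain \<beta> where "\<beta> \<in> S" using assms(2) by blast
      then have "?l \<beta> \<le> Max (?l ` S)" using assms(1) by simp
      ultimately show ?thesis by linarith
    qed (use assms(1) in simp)
    then show "Max (range ?l) \<le> Max (?l ` S)"
      by (intro Max.boundedI finite_range_abs_lookup) auto
    show "Max (?l ` S) \<le> Max (range ?l)"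
      using assms(2) by (intro Max_mono finite_range_abs_lookup) auto
  qed
  ultimately show ?thesis by (simp add: coeff_norm_def)
qed

section \<open>Coefficientwise limits in bounded degree\<close>

lemma tendsto_Max_image:
  fixes u :: "'i \<Rightarrow> 'a \<Rightarrow> real"
  assumes "finite S" "S \<noteq> {}" "\<And>a. a \<in> S \<Longrightarrow> ((\<lambda>i. u i a) \<longlongrightarrow> v a) G"
  shows "((\<lambda>i. Max (u i ` S)) \<longlongrightarrow> Max (v ` S)) G"
  using assms
proof (induction S rule: finite_ne_induct)
  case (insert a S)
  then have "((\<lambda>i. max (u i a) (Max (u i ` S))) \<longlongrightarrow> max (v a) (Max (v ` S))) G"
    by (intro tendsto_max) auto
  then show ?case using insert by simp
qed simp

lemma tendsto_poly_eval:
  fixes h :: "nat \<Rightarrow> 'n::finite rpoly"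
  assumes lim: "\<And>\<alpha>. (\<lambda>i. Poly_Mapping.lookup (h i) \<alpha>) \<longlonglongrightarrow> Poly_Mapping.lookup p \<alpha>"
    and "\<And>i. h i \<in> polys_upto t" "p \<in> polys_upto t"
  shows "(\<lambda>i. poly_eval (h i) x) \<longlonglongrightarrow> poly_eval p x"
  unfolding poly_eval_eq_sum[OF finite_exponents_upto assms(2)[unfolded polys_upto_iff]]
    poly_eval_eq_sum[OF finite_exponents_upto assms(3)[unfolded polys_upto_iff]]
  by (intro tendsto_intros lim)

lemma tendsto_coeff_norm:
  fixes h :: "nat \<Rightarrow> 'n::finite rpoly"
  assumes lim: "\<And>\<alpha>. (\<lambda>i. Poly_Mapping.lookup (h i) \<alpha>) \<longlonglongrightarrow> Poly_Mapping.lookup p \<alpha>"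
    and "\<And>i. h i \<in> polys_upto t" "p \<in> polys_upto t" "f \<in> polys_upto t"
  shows "(\<lambda>i. coeff_norm k (h i - f)) \<longlonglongrightarrow> coeff_norm k (p - f)"
proof -
  let ?S = "exponents_upto t :: ('n \<Rightarrow>\<^sub>0 nat) set"
  have keys: "Poly_Mapping.keys (q - f) \<subseteq> ?S" if "q \<in> polys_upto t" for q
    using that assms(4) keys_diff[of q f] unfolding polys_upto_iff by blast
  have ne: "?S \<noteq> {}" using zero_in_exponents_upto by blast
  note eq = coeff_norm_eq[OF finite_exponents_upto ne keys]
  have "(\<lambda>i. \<bar>Poly_Mapping.lookup (h i - f) \<alpha>\<bar>) \<longlonglongrightarrow> \<bar>Poly_Mapping.lookup (p - f) \<alpha>\<bar>" for \<alpha>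
    unfolding lookup_minus by (intro tendsto_intros lim)
  moreover from this have "(\<lambda>i. Max ((\<lambda>\<alpha>. \<bar>Poly_Mapping.lookup (h i - f) \<alpha>\<bar>) ` ?S))
      \<longlonglongrightarrow> Max ((\<lambda>\<alpha>. \<bar>Poly_Mapping.lookup (p - f) \<alpha>\<bar>) ` ?S)"
    by (intro tendsto_Max_image finite_exponents_upto ne)
  moreover have "(\<lambda>i. (Poly_Mapping.lookup (h i - f) \<alpha>)\<^sup>2)
      \<longlonglongrightarrow> (Poly_Mapping.lookup (p - f) \<alpha>)\<^sup>2" for \<alpha>
    unfolding lookup_minus by (intro tendsto_intros lim)
  ultimately show ?thesis
    unfolding eq[OF assms(2)] eq[OF assms(3)] by (auto intro!: tendsto_sum)
qed

section \<open>The inverse problem\<close>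

lemma bdd_below_coeff_norm: "bdd_below ((\<lambda>h. coeff_norm k (h - f)) ` A)"
  by (rule bdd_belowI2[of _ 0]) (rule coeff_norm_nonneg)

lemma inv_value_optimal:
  assumes "inv_optimal k f C h"
  shows "inv_value k f C = coeff_norm k (h - f)"
proof -
  have "h \<in> inv_feasible f C"
    and "\<And>p. p \<in> inv_feasible f C \<Longrightarrow> coeff_norm k (h - f) \<le> coeff_norm k (p - f)"
    using assms by (auto simp: inv_optimal_def is_arg_min_linorder)
  then show ?thesis
    unfolding inv_value_def by (intro cInf_eq_minimum) auto
qed

text \<open>The infimum over an empty set is an unspecified real, hence the nonemptiness.\<close>

lemma inv_value_antimono:
  assumes "inv_feasible f C \<subseteq> inv_feasible f D" "inv_feasible f C \<noteq> {}"
  shows "inv_value k f D \<le> inv_value k f C"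
  unfolding inv_value_def using assms
  by (intro cINF_superset_mono bdd_below_coeff_norm) auto

theorem proposition3p6:
  fixes f :: "'n::finite rpoly" and g :: "nat \<Rightarrow> 'n rpoly" and m d0 :: nat
    and K :: "(real ^ 'n) set" and k :: enat
    and F :: "nat \<Rightarrow> 'n rpoly" and fstar :: "'n rpoly"
  assumes d0: "d0 = tdegree f"
    and K: "K = semialg_set m g"
    and K_interior: "interior K \<noteq> {}"
    and zero_in_K: "0 \<in> K"
    and k: "k \<in> {1, 2, \<infinity>}"
    and F_opt: "\<And>d. inv_optimal k f (trunc_quad_module m g d) (F d)"
    and fstar_opt: "inv_optimal k f (Psd d0 K) fstar"
  shows "antimono (\<lambda>d. inv_value k f (trunc_quad_module m g d))
    \<and> (\<exists>rho_hat. 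
          (\<lambda>d. inv_value k f (trunc_quad_module m g d)) \<longlonglongrightarrow> rho_hat
        \<and> rho_hat \<ge> inv_value k f (Psd d0 K)
        \<and> (\<forall>f_hat\<in>polys_upto d0. accumulation_point F f_hat \<longrightarrow>
              f_hat - const_poly (poly_eval f_hat 0) \<in> Psd d0 K
            \<and> coeff_norm k (f_hat - f) = rho_hat)
        \<and> (fstar - const_poly (poly_eval fstar 0) \<in> quad_module m g \<longrightarrow>
              (\<exists>d. inv_value k f (trunc_quad_module m g d) = rho_hat
                 \<and> rho_hat = inv_value k f (Psd d0 K))))"
proof -
  let ?v = "\<lambda>d. inv_value k f (trunc_quad_module m g d)"
  let ?rho = "inv_value k f (Psd d0 K)"
  have F_feas: "F d \<in> inv_feasible f (trunc_quad_module m g d)" for d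
    using F_opt by (auto simp: inv_optimal_def is_arg_min_def)
  have to_Psd: "inv_feasible f (trunc_quad_module m g d) \<subseteq> inv_feasible f (Psd d0 K)" for d
    unfolding d0 K by (rule inv_feasible_trunc_subset_Psd)
  have anti: "antimono ?v"
  proof
    fix d e :: nat assume "d \<le> e"
    then have "inv_feasible f (trunc_quad_module m g d)
        \<subseteq> inv_feasible f (trunc_quad_module m g e)"
      using trunc_quad_module_mono unfolding inv_feasible_def by blast
    then show "?v e \<le> ?v d"
      using F_feas by (intro inv_value_antimono) auto
  qed
  have lower: "?rho \<le> ?v d" for d
    using F_feas by (intro inv_value_antimono to_Psd) auto
  obtain rho_hat where lim: "?v \<longlonglongrightarrow> rho_hat" and le: "\<And>d. rho_hat \<le> ?v d"
    using decseq_convergent[OF anti, of ?rho] lower by blast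
  have ge: "?rho \<le> rho_hat"
    using lim lower by (intro LIMSEQ_le_const) auto

  have accum: "f_hat - const_poly (poly_eval f_hat 0) \<in> Psd d0 K \<and> coeff_norm k (f_hat - f) = rho_hat"
    if hat: "f_hat \<in> polys_upto d0" and acc: "accumulation_point F f_hat" for f_hat
  proof -
    obtain r where r: "strict_mono r"
      and conv: "(\<lambda>i. Poly_Mapping.lookup (F (r i))) \<longlonglongrightarrow> Poly_Mapping.lookup f_hat"
      using acc unfolding accumulation_point_def by blast
    have coeff: "(\<lambda>i. Poly_Mapping.lookup (F (r i)) \<alpha>) \<longlonglongrightarrow> Poly_Mapping.lookup f_hat \<alpha>" for \<alpha>
      by (rule continuous_on_tendsto_compose[OF continuous_on_product_coordinates conv]) auto
    have F_deg: "F (r i) \<in> polys_upto d0" for i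
      using F_feas by (auto simp: inv_feasible_def d0)
    have f_deg: "f \<in> polys_upto d0" by (simp add: polys_upto_def d0)
    have "poly_eval f_hat x \<ge> poly_eval f_hat 0" if "x \<in> K" for x
    proof (rule LIMSEQ_le)
      show "(\<lambda>i. poly_eval (F (r i)) 0) \<longlonglongrightarrow> poly_eval f_hat 0"
        and "(\<lambda>i. poly_eval (F (r i)) x) \<longlonglongrightarrow> poly_eval f_hat x"
        by (rule tendsto_poly_eval[OF coeff F_deg hat])+
      have "F (r i) \<in> inv_feasible f (Psd d0 K)" for i
        using F_feas to_Psd by blast
      then show "\<exists>N. \<forall>i\<ge>N. poly_eval (F (r i)) 0 \<le> poly_eval (F (r i)) x"
        using that by (auto simp: inv_feasible_def Psd_def poly_eval_diff poly_eval_const)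
    qed
    then have "f_hat - const_poly (poly_eval f_hat 0) \<in> Psd d0 K"
      using hat by (auto simp: Psd_def diff_const_in_polys_upto poly_eval_diff poly_eval_const)
    moreover have "coeff_norm k (f_hat - f) = rho_hat"
    proof (rule LIMSEQ_unique)
      show "(\<lambda>i. coeff_norm k (F (r i) - f)) \<longlonglongrightarrow> coeff_norm k (f_hat - f)"
        by (rule tendsto_coeff_norm[OF coeff F_deg hat f_deg])
      show "(\<lambda>i. coeff_norm k (F (r i) - f)) \<longlonglongrightarrow> rho_hat"
        using LIMSEQ_subseq_LIMSEQ[OF lim r] by (simp add: o_def inv_value_optimal[OF F_opt])
    qed
    ultimately show ?thesis ..
  qed

  have exact: "\<exists>d. ?v d = rho_hat \<and> rho_hat = ?rho"
    if mem: "fstar - const_poly (poly_eval fstar 0) \<in> quad_module m g"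
  proof -
    obtain d where "fstar - const_poly (poly_eval fstar 0) \<in> trunc_quad_module m g d"
      using mem by (rule quad_module_imp_trunc)
    moreover have "fstar \<in> polys_upto (tdegree f)"
      using fstar_opt by (auto simp: inv_optimal_def is_arg_min_def inv_feasible_def)
    ultimately have "fstar \<in> inv_feasible f (trunc_quad_module m g d)"
      by (simp add: inv_feasible_def)
    then have "?v d \<le> coeff_norm k (fstar - f)"
      unfolding inv_value_def by (intro cINF_lower bdd_below_coeff_norm)
    then have "?v d \<le> ?rho"
      by (simp add: inv_value_optimal[OF fstar_opt])
    then show ?thesis
      using ge le[of d] by (intro exI[of _ d]) linarith
  qed

  show ?thesis
    using anti lim ge accum exact by blast
qed

end
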